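(* Let $D$ be a defeasible theory and $S_D$ its compiled program. Then $S_D$ is: (1) a Datalog$^\neg$ program iff $D$ is function-free; (2) variable-free iff $D$ is variable-free; (3) range-restricted iff $D$ is range-restricted; (4) safe iff $D$ is range-restricted; (5) call-consistent; (6) stratified if $D$ is hierarchical; (7) locally stratified if $D$ is locally hierarchical.
   Context: Defeasible theories. Terms are built from variables, constants and function symbols. A literal is an atom $p(t_1,\dots,t_n)$ or its classical negation; ${\sim}q$ is the complementary literal. A defeasible theory $D=(F,R,>)$ consists of a finite set $F$ of literals (facts), a finite set $R$ of labelled rules $r$ with finite antecedent set $A(r)$, consequent $C(r)$ and kind strict ($\to$), defeasible ($\Rightarrow$) or defeater ($\leadsto$), and an acyclic superiority relation $>$ on labels. $D$ is function-free if no rule or fact contains a function symbol other than constants; range-restricted if every fact is variable-free and every variable in the consequent of a rule also occurs in its antecedent; hierarchical if there is a mapping $m$ from predicates to non-negative integers (with $p(\dots)$ and $\neg p(\dots)$ both mapped to $m(p)$) such that for every rule the consequent is mapped to a greater value than every antecedent literal; locally hierarchical if the set of ground instances of $D$ is hierarchical when each ground atom is treated as a proposition. Compiled program. For a literal $q$ with predicate $p$, $\mathtt{q}$ denotes $\mathtt{p}$ if $q$ is positive and $\mathtt{not\_p}$ if negative; $\mathtt{{\sim}q}$ is the name of the complement; predicate names are formed by concatenation; rule labels are constants. $S_D$ consists exactly of: (i) for each fact $q(\vec a)$: unit clauses $\mathtt{definitely\_q}(\vec a)$, $\mathtt{lambda\_q}(\vec a)$, $\mathtt{defeasibly\_q}(\vec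 a)$; (ii) for each strict rule $r:q_1(\vec a_1),\dots,q_n(\vec a_n)\to q(\vec a)$: $\mathtt{definitely\_q}(\vec a)\,\text{:-}\,\mathtt{body}^\Delta_r(\vec a)$, $\mathtt{lambda\_q}(\vec a)\,\text{:-}\,\mathtt{body}^\Delta_r(\vec a)$, $\mathtt{defeasibly\_q}(\vec a)\,\text{:-}\,\mathtt{body}^\Delta_r(\vec a)$, $\mathtt{body}^\Delta_r(\vec a)\,\text{:-}\,\mathtt{definitely\_q_1}(\vec a_1),\dots,\mathtt{definitely\_q_n}(\vec a_n)$; (iii) for each strict or defeasible rule $r:q_1(\vec a_1),\dots,q_n(\vec a_n)\hookrightarrow q(\vec a)$: $\mathtt{lambda\_q}(\vec a)\,\text{:-}\,not\ \mathtt{definitely\_{\sim}q}(\vec a),\mathtt{body}^\lambda_r(\vec a)$ and $\mathtt{defeasibly\_q}(\vec a)\,\text{:-}\,not\ \mathtt{definitely\_{\sim}q}(\vec a),\mathtt{body}^d_r(\vec a),not\ \mathtt{overruled\_q}(\vec a)$; (iv) for each rule $s$ of any kind, $s:q_1(\vec a_1),\dots,q_n(\vec a_n)\hookrightarrow q(\vec a)$: $\mathtt{body}^\lambda_s(\vec a)\,\text{:-}\,\mathtt{lambda\_q_1}(\vec a_1),\dots,\mathtt{lambda\_q_n}(\vec a_n)$, $\mathtt{body}^d_s(\vec a)\,\text{:-}\,\mathtt{defeasibly\_q_1}(\vec a_1),\dots,\mathtt{defeasibly\_q_n}(\vec a_n)$, $\mathtt{overruled\_{\sim}q}(\vec a)\,\text{:-}\,\mathtt{body}^\lambda_s(\vec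 a),not\ \mathtt{defeated\_q}(s,\vec a)$; (v) for each strict or defeasible rule $t$ with consequent $q(\vec a)$ and each rule $s$ with consequent of the form ${\sim}q(\dots)$ with $t>s$: $\mathtt{defeated\_{\sim}q}(s,\vec a)\,\text{:-}\,\mathtt{body}^d_t(\vec a)$. Logic programs. A Datalog$^\neg$ program is one whose only terms are constants and variables. A program is range-restricted if every variable in the head of a clause appears in a positive body literal, and safe if every variable in a clause appears in a positive body literal of that clause. For predicates, $p\sqsupseteq_{+1}q$ ($p\sqsupseteq_{-1}q$) if some clause has head predicate $p$ and a positive (negative) body literal with predicate $q$; $\geq_{+1},\geq_{-1}$ are the least relations with $p\geq_{+1}p$ and ($p\sqsupseteq_i q$ and $q\geq_j r$ imply $p\geq_{i\cdot j}r$). A program is call-consistent if no predicate $p$ has $p\geq_{-1}p$. A program is stratified if there is a mapping $m$ from predicates to non-negative integers such that for every clause $m(\text{head})\geq m(B)$ for each positive body literal $B$ and $m(\text{head})>m(C)$ for each negative body literal $not\ C$; it is locally stratified if the set of its ground instances is stratified when each ground atom is treated as a propositional predicate. *)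

theory Defs
  imports Main
begin

(* Const is the only source of constants; the symbols used with Fun are the
   function symbols other than constants. *)
datatype (consts_trm: 'c, funs_trm: 'f, vars_trm: 'v) trm =
    Var 'v
  | Const 'c
  | Fun 'f "('c, 'f, 'v) trm list"

datatype ('p, 't) atom = Atom (pred: 'p) (args: "'t list")

datatype 'a literal = Pos (atom_of: 'a) | Neg (atom_of: 'a)

fun complement :: "'a literal \<Rightarrow> 'a literal" where
  "complement (Pos a) = Neg a"
| "complement (Neg a) = Pos a"

primrec subst :: "('v \<Rightarrow> ('c, 'f, 'w) trm) \<Rightarrow> ('c, 'f, 'v) trm \<Rightarrow> ('c, 'f, 'w) trm" where
  "subst \<sigma> (Var x) = \<sigma> x"
| "subst \<sigma> (Const c) = Const c"
| "subst \<sigma> (Fun f ts) = Fun f (map (subst \<sigma>) ts)"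

(* Ground instances are taken over all ground terms of the language.  Symbols that do not
   occur could be mapped to one fixed constant, so this agrees with grounding over the
   occurring symbols (plus a constant if there is none). *)
definition ground_subst :: "('v \<Rightarrow> ('c, 'f, 'v) trm) \<Rightarrow> bool" where
  "ground_subst \<sigma> \<longleftrightarrow> (\<forall>x. vars_trm (\<sigma> x) = {})"

definition atom_vars :: "('p, ('c, 'f, 'v) trm) atom \<Rightarrow> 'v set" where
  "atom_vars A = (\<Union>t\<in>set (args A). vars_trm t)"

definition atom_funs :: "('p, ('c, 'f, 'v) trm) atom \<Rightarrow> 'f set" where
  "atom_funs A = (\<Union>t\<in>set (args A). funs_trm t)"

definition subst_atom ::
  "('v \<Rightarrow> ('c, 'f, 'v) trm) \<Rightarrow> ('p, ('c, 'f, 'v) trm) atom \<Rightarrow> ('p, ('c, 'f, 'v) trm) atom" where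
  "subst_atom \<sigma> = map_atom id (subst \<sigma>)"

(* An atom regarded as a proposition: it becomes a predicate symbol without arguments. *)
definition prop_atom :: "('p, 't) atom \<Rightarrow> (('p, 't) atom, 't) atom" where
  "prop_atom A = Atom A []"

datatype rule_kind = Strict | Defeasible | Defeater

datatype ('l, 'a) rule =
  Rule (label: 'l) (kind: rule_kind) (antecedent: "'a literal set") (consequent: "'a literal")

datatype ('l, 'a) dtheory =
  DTheory (facts: "'a literal set") (rules: "('l, 'a) rule set") (superiority: "('l \<times> 'l) set")

(* (t, s) \<in> superiority D means t > s.  A label identifies its rule. *)
definition defeasible_theory :: "('l, 'a) dtheory \<Rightarrow> bool" where
  "defeasible_theory D \<longleftrightarrow>
     finite (facts D) \<and> finite (rules D) \<and>
     (\<forall>r\<in>rules D. finite (antecedent r)) \<and>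
     inj_on label (rules D) \<and>
     acyclic (superiority D)"

definition rule_literals :: "('l, 'a) rule \<Rightarrow> 'a literal set" where
  "rule_literals r = insert (consequent r) (antecedent r)"

definition theory_literals :: "('l, 'a) dtheory \<Rightarrow> 'a literal set" where
  "theory_literals D = facts D \<union> (\<Union>r\<in>rules D. rule_literals r)"

definition map_rule_atoms :: "('a \<Rightarrow> 'b) \<Rightarrow> ('l, 'a) rule \<Rightarrow> ('l, 'b) rule" where
  "map_rule_atoms h r =
     Rule (label r) (kind r) (map_literal h ` antecedent r) (map_literal h (consequent r))"

definition function_free :: "('l, ('p, ('c, 'f, 'v) trm) atom) dtheory \<Rightarrow> bool" where
  "function_free D \<longleftrightarrow> (\<forall>q\<in>theory_literals D. atom_funs (atom_of q) = {})"

definition variable_free_theory :: "('l, ('p, ('c, 'f, 'v) trm) atom) dtheory \<Rightarrow> bool" where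
  "variable_free_theory D \<longleftrightarrow> (\<forall>q\<in>theory_literals D. atom_vars (atom_of q) = {})"

definition range_restricted_theory :: "('l, ('p, ('c, 'f, 'v) trm) atom) dtheory \<Rightarrow> bool" where
  "range_restricted_theory D \<longleftrightarrow>
     (\<forall>q\<in>facts D. atom_vars (atom_of q) = {}) \<and>
     (\<forall>r\<in>rules D. atom_vars (atom_of (consequent r)) \<subseteq> (\<Union>q\<in>antecedent r. atom_vars (atom_of q)))"

definition hierarchical_rules :: "('l, ('p, 't) atom) rule set \<Rightarrow> bool" where
  "hierarchical_rules R \<longleftrightarrow>
     (\<exists>m :: 'p \<Rightarrow> nat. \<forall>r\<in>R. \<forall>q\<in>antecedent r.
        m (pred (atom_of q)) < m (pred (atom_of (consequent r))))"

definition hierarchical :: "('l, ('p, 't) atom) dtheory \<Rightarrow> bool" where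
  "hierarchical D \<longleftrightarrow> hierarchical_rules (rules D)"

definition ground_rules ::
  "('l, ('p, ('c, 'f, 'v) trm) atom) rule set \<Rightarrow> ('l, ('p, ('c, 'f, 'v) trm) atom) rule set" where
  "ground_rules R = {map_rule_atoms (subst_atom \<sigma>) r | \<sigma> r. ground_subst \<sigma> \<and> r \<in> R}"

definition locally_hierarchical :: "('l, ('p, ('c, 'f, 'v) trm) atom) dtheory \<Rightarrow> bool" where
  "locally_hierarchical D \<longleftrightarrow>
     hierarchical_rules (map_rule_atoms prop_atom ` ground_rules (rules D))"

datatype 'a clause = Clause (head: 'a) (pos_body: "'a set") (neg_body: "'a set")

definition clause_atoms :: "'a clause \<Rightarrow> 'a set" where
  "clause_atoms c = insert (head c) (pos_body c \<union> neg_body c)"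

definition map_clause_atoms :: "('a \<Rightarrow> 'b) \<Rightarrow> 'a clause \<Rightarrow> 'b clause" where
  "map_clause_atoms h c = Clause (h (head c)) (h ` pos_body c) (h ` neg_body c)"

definition datalog_program :: "('p, ('c, 'f, 'v) trm) atom clause set \<Rightarrow> bool" where
  "datalog_program P \<longleftrightarrow>
     (\<forall>c\<in>P. \<forall>A\<in>clause_atoms c. \<forall>t\<in>set (args A). (\<exists>a. t = Const a) \<or> (\<exists>x. t = Var x))"

definition variable_free_program :: "('p, ('c, 'f, 'v) trm) atom clause set \<Rightarrow> bool" where
  "variable_free_program P \<longleftrightarrow> (\<forall>c\<in>P. \<forall>A\<in>clause_atoms c. atom_vars A = {})"

definition range_restricted_program :: "('p, ('c, 'f, 'v) trm) atom clause set \<Rightarrow> bool" where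
  "range_restricted_program P \<longleftrightarrow>
     (\<forall>c\<in>P. atom_vars (head c) \<subseteq> (\<Union>B\<in>pos_body c. atom_vars B))"

definition safe_program :: "('p, ('c, 'f, 'v) trm) atom clause set \<Rightarrow> bool" where
  "safe_program P \<longleftrightarrow>
     (\<forall>c\<in>P. (\<Union>A\<in>clause_atoms c. atom_vars A) \<subseteq> (\<Union>B\<in>pos_body c. atom_vars B))"

(* The integer is the sign, 1 or -1. *)
inductive directly_depends :: "('p, 't) atom clause set \<Rightarrow> int \<Rightarrow> 'p \<Rightarrow> 'p \<Rightarrow> bool"
  for P where
  positive: "c \<in> P \<Longrightarrow> B \<in> pos_body c \<Longrightarrow> directly_depends P 1 (pred (head c)) (pred B)"
| negative: "c \<in> P \<Longrightarrow> B \<in> neg_body c \<Longrightarrow> directly_depends P (-1) (pred (head c)) (pred B)"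

inductive depends :: "('p, 't) atom clause set \<Rightarrow> int \<Rightarrow> 'p \<Rightarrow> 'p \<Rightarrow> bool"
  for P where
  refl: "depends P 1 p p"
| step: "directly_depends P i p q \<Longrightarrow> depends P j q r \<Longrightarrow> depends P (i * j) p r"

definition call_consistent :: "('p, 't) atom clause set \<Rightarrow> bool" where
  "call_consistent P \<longleftrightarrow> (\<nexists>p. depends P (-1) p p)"

definition stratified :: "('p, 't) atom clause set \<Rightarrow> bool" where
  "stratified P \<longleftrightarrow>
     (\<exists>m :: 'p \<Rightarrow> nat. \<forall>c\<in>P.
        (\<forall>B\<in>pos_body c. m (pred (head c)) \<ge> m (pred B)) \<and>
        (\<forall>C\<in>neg_body c. m (pred (head c)) > m (pred C)))"

definition ground_clauses ::
  "('p, ('c, 'f, 'v) trm) atom clause set \<Rightarrow> ('p, ('c, 'f, 'v) trm) atom clause set" where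
  "ground_clauses P = {map_clause_atoms (subst_atom \<sigma>) c | \<sigma> c. ground_subst \<sigma> \<and> c \<in> P}"

definition locally_stratified :: "('p, ('c, 'f, 'v) trm) atom clause set \<Rightarrow> bool" where
  "locally_stratified P \<longleftrightarrow> stratified (map_clause_atoms prop_atom ` ground_clauses P)"

(* The names p and not_p are rendered as Pos p and Neg p, and a concatenated name as a
   constructor applied to such a name.  Hence different names never clash, and the name of
   the complementary literal is obtained by complement. *)
datatype ('l, 'p) cpred =
    Definitely "'p literal"
  | Lambda "'p literal"
  | Defeasibly "'p literal"
  | Overruled "'p literal"
  | Defeated "'p literal"
  | Body_Delta 'l
  | Body_lambda 'l
  | Body_d 'l

(* The constants of the program are those of the theory (Inl) and the rule labels (Inr). *)
type_synonym ('l, 'p, 'c, 'f, 'v) catom = "(('l, 'p) cpred, ('c + 'l, 'f, 'v) trm) atom"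

definition lit_name :: "('p, 't) atom literal \<Rightarrow> 'p literal" where
  "lit_name q = map_literal pred q"

definition lit_args :: "('p, ('c, 'f, 'v) trm) atom literal \<Rightarrow> ('c + 'l, 'f, 'v) trm list" where
  "lit_args q = map (map_trm Inl id id) (args (atom_of q))"

(* For example, lit_atom Definitely q is definitely_q(a) for a literal q(a). *)
definition lit_atom ::
  "('p literal \<Rightarrow> ('l, 'p) cpred) \<Rightarrow> ('p, ('c, 'f, 'v) trm) atom literal \<Rightarrow>
   ('l, 'p, 'c, 'f, 'v) catom" where
  "lit_atom K q = Atom (K (lit_name q)) (lit_args q)"

(* The arguments of a body atom are those of the consequent of the rule. *)
definition body_atom ::
  "('l \<Rightarrow> ('l, 'p) cpred) \<Rightarrow> ('l, ('p, ('c, 'f, 'v) trm) atom) rule \<Rightarrow>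
   ('l, 'p, 'c, 'f, 'v) catom" where
  "body_atom K r = Atom (K (label r)) (lit_args (consequent r))"

(* defeated_q(s, a) for a literal q(a) and a label s *)
definition defeated_atom ::
  "('p, ('c, 'f, 'v) trm) atom literal \<Rightarrow> 'l \<Rightarrow> ('l, 'p, 'c, 'f, 'v) catom" where
  "defeated_atom q s = Atom (Defeated (lit_name q)) (Const (Inr s) # lit_args q)"

definition fact_clauses ::
  "('p, ('c, 'f, 'v) trm) atom literal \<Rightarrow> ('l, 'p, 'c, 'f, 'v) catom clause set" where
  "fact_clauses q =
     {Clause (lit_atom Definitely q) {} {},
      Clause (lit_atom Lambda q) {} {},
      Clause (lit_atom Defeasibly q) {} {}}"

definition strict_clauses ::
  "('l, ('p, ('c, 'f, 'v) trm) atom) rule \<Rightarrow> ('l, 'p, 'c, 'f, 'v) catom clause set" where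
  "strict_clauses r =
     (let q = consequent r in
      {Clause (lit_atom Definitely q) {body_atom Body_Delta r} {},
       Clause (lit_atom Lambda q) {body_atom Body_Delta r} {},
       Clause (lit_atom Defeasibly q) {body_atom Body_Delta r} {},
       Clause (body_atom Body_Delta r) (lit_atom Definitely ` antecedent r) {}})"

definition supportive_clauses ::
  "('l, ('p, ('c, 'f, 'v) trm) atom) rule \<Rightarrow> ('l, 'p, 'c, 'f, 'v) catom clause set" where
  "supportive_clauses r =
     (let q = consequent r in
      {Clause (lit_atom Lambda q)
         {body_atom Body_lambda r} {lit_atom Definitely (complement q)},
       Clause (lit_atom Defeasibly q)
         {body_atom Body_d r} {lit_atom Definitely (complement q), lit_atom Overruled q}})"

definition rule_clauses ::
  "('l, ('p, ('c, 'f, 'v) trm) atom) rule \<Rightarrow> ('l, 'p, 'c, 'f, 'v) catom clause set" where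
  "rule_clauses s =
     (let q = consequent s in
      {Clause (body_atom Body_lambda s) (lit_atom Lambda ` antecedent s) {},
       Clause (body_atom Body_d s) (lit_atom Defeasibly ` antecedent s) {},
       Clause (lit_atom Overruled (complement q))
         {body_atom Body_lambda s} {defeated_atom q (label s)}})"

definition superiority_clause ::
  "('l, ('p, ('c, 'f, 'v) trm) atom) rule \<Rightarrow> ('l, ('p, ('c, 'f, 'v) trm) atom) rule \<Rightarrow>
   ('l, 'p, 'c, 'f, 'v) catom clause" where
  "superiority_clause t s =
     Clause (defeated_atom (complement (consequent t)) (label s)) {body_atom Body_d t} {}"

(* In the last component only the predicates of the two consequents are compared,
   not their arguments. *)
definition compiled ::
  "('l, ('p, ('c, 'f, 'v) trm) atom) dtheory \<Rightarrow> ('l, 'p, 'c, 'f, 'v) catom clause set" where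
  "compiled D =
     (\<Union>q\<in>facts D. fact_clauses q) \<union>
     (\<Union>r\<in>{r \<in> rules D. kind r = Strict}. strict_clauses r) \<union>
     (\<Union>r\<in>{r \<in> rules D. kind r \<in> {Strict, Defeasible}}. supportive_clauses r) \<union>
     (\<Union>s\<in>rules D. rule_clauses s) \<union>
     {superiority_clause t s | t s.
        t \<in> rules D \<and> kind t \<in> {Strict, Defeasible} \<and> s \<in> rules D \<and>
        lit_name (consequent s) = complement (lit_name (consequent t)) \<and>
        (label t, label s) \<in> superiority D}"

end

(* Call-consistency: a dependency never leads upwards in the ordering {Definitely, Body_Delta},
   {Lambda, Body_lambda}, everything else; within the last group, Overruled can be given
   sign -1 and the others sign 1 so that each dependency has the product of the signs of
   its ends.  A cycle stays inside one group, hence is positive.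

   Stratification: if m witnesses that D is hierarchical, put the first two groups at levels
   0 and 1, and around each predicate p leave room for Defeated < Overruled < Defeasibly
   at 3 m(p) + 2, 3 m(p) + 3, 3 m(p) + 4.  Body_d of a rule for p shares the level of
   Defeated p, which is above Defeasibly of each antecedent because m decreases. *)
theory Submission
  imports Defs
begin

subsection \<open>Function symbols, variables and safety\<close>

lemma funs_trm_empty_iff: "funs_trm t = {} \<longleftrightarrow> (\<exists>a. t = Const a) \<or> (\<exists>x. t = Var x)"
  by (cases t) auto

lemma funs_map_consts [simp]: "funs_trm (map_trm g id id t) = funs_trm t"
  by (simp add: trm.set_map)

lemma vars_map_consts [simp]: "vars_trm (map_trm g id id t) = vars_trm t"
  by (simp add: trm.set_map)

text \<open>Used with \<open>h = Inl\<close> and \<open>g\<close> a left inverse: a program instance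
  of a term of \<open>D\<close>, mapped back along \<open>g\<close>, is an instance of the original
  term.\<close>

lemma map_consts_subst:
  "map_trm g id id (subst \<sigma> (map_trm h id id t)) = subst (map_trm g id id \<circ> \<sigma>) t"
  if "g \<circ> h = id"
  using that by (induction t) (auto simp: fun_eq_iff)

lemma atom_of_complement [simp]: "atom_of (complement q) = atom_of q"
  by (cases q) auto

lemma lit_name_complement [simp]: "lit_name (complement q) = complement (lit_name q)"
  by (cases q) (auto simp: lit_name_def)

lemma atom_of_lit_name [simp]: "atom_of (lit_name q) = pred (atom_of q)"
  by (cases q) (auto simp: lit_name_def)

lemma lit_args_complement [simp]: "lit_args (complement q) = lit_args q"
  by (simp add: lit_args_def)

lemma set_lit_args: "set (lit_args q) = map_trm Inl id id ` set (args (atom_of q))"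
  by (simp add: lit_args_def)

lemma atom_vars_compiled [simp]:
  "atom_vars (lit_atom K q) = atom_vars (atom_of q)"
  "atom_vars (body_atom B r) = atom_vars (atom_of (consequent r))"
  "atom_vars (defeated_atom q s) = atom_vars (atom_of q)"
  by (simp_all add: atom_vars_def lit_atom_def body_atom_def defeated_atom_def set_lit_args)

lemmas clause_set_defs =
  fact_clauses_def strict_clauses_def supportive_clauses_def rule_clauses_def
  superiority_clause_def Let_def

lemma compiled_cases [consumes 1, case_names fact strict supportive body superiority]:
  assumes "c \<in> compiled D"
  obtains q where "q \<in> facts D" "c \<in> fact_clauses q"
  | r where "r \<in> rules D" "c \<in> strict_clauses r"
  | r where "r \<in> rules D" "c \<in> supportive_clauses r"
  | r where "r \<in> rules D" "c \<in> rule_clauses r"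
  | t s where "t \<in> rules D" "s \<in> rules D" "c = superiority_clause t s"
  using assms unfolding compiled_def by blast

text \<open>These clauses suffice to read properties of \<open>D\<close> off the program: they cover
  all facts and, for rules of every kind, defeaters included, the arguments of the consequent (in
  the head) and of the antecedent.\<close>

lemma compiled_intros:
  "q \<in> facts D \<Longrightarrow> Clause (lit_atom Definitely q) {} {} \<in> compiled D"
  "r \<in> rules D \<Longrightarrow>
     Clause (body_atom Body_lambda r) (lit_atom Lambda ` antecedent r) {} \<in> compiled D"
  unfolding compiled_def by (auto simp: fact_clauses_def rule_clauses_def Let_def)

text \<open>Parts (1) and (2) are instances. The only argument in the program that is not copied
  from a literal of \<open>D\<close> is the label constant of a defeated atom, hence the assumption
  on \<open>P\<close>.\<close>

lemma all_compiled_terms_iff: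
  fixes D :: "('l, ('p, ('c, 'f, 'v) trm) atom) dtheory"
    and P :: "('c + 'l, 'f, 'v) trm \<Rightarrow> bool"
  assumes "\<And>s. P (Const (Inr s))"
  shows "(\<forall>c\<in>compiled D. \<forall>A\<in>clause_atoms c. \<forall>t\<in>set (args A). P t) \<longleftrightarrow>
         (\<forall>q\<in>theory_literals D. \<forall>t\<in>set (lit_args q). P t)"
    (is "?L \<longleftrightarrow> ?R")
proof
  assume L: ?L
  show ?R
  proof (intro ballI)
    fix q and t :: "('c + 'l, 'f, 'v) trm"
    assume q: "q \<in> theory_literals D" and t: "t \<in> set (lit_args q)"
    then consider "q \<in> facts D" | r where "r \<in> rules D" "q = consequent r \<or> q \<in> antecedent r"
      by (auto simp: theory_literals_def rule_literals_def)
    then show "P t"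
    proof cases
      case 1
      then show ?thesis
        using L[rule_format, OF compiled_intros(1)] t
        by (auto simp: clause_atoms_def lit_atom_def)
    next
      case (2 r)
      let ?A = "if q = consequent r then body_atom Body_lambda r else lit_atom Lambda q"
      have "?A \<in> clause_atoms (Clause (body_atom Body_lambda r) (lit_atom Lambda ` antecedent r) {})"
        using 2(2) by (auto simp: clause_atoms_def)
      moreover have "t \<in> set (args ?A)"
        using t by (auto simp: body_atom_def lit_atom_def)
      ultimately show ?thesis
        using L compiled_intros(2)[OF 2(1)] by blast
    qed
  qed
next
  assume R: ?R
  then have R_fact: "\<forall>t\<in>set (lit_args q). P t" if "q \<in> facts D" for q
    using that unfolding theory_literals_def by blast
  from R have R_rule: "\<forall>t\<in>set (lit_args (consequent r)). P t"
      "\<forall>q\<in>antecedent r. \<forall>t\<in>set (lit_args q). P t" if "r \<in> rules D" for r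
    using that unfolding theory_literals_def rule_literals_def by blast+
  show ?L
  proof (rule ballI)
    fix c assume "c \<in> compiled D"
    then show "\<forall>A\<in>clause_atoms c. \<forall>t\<in>set (args A). P t"
      by (cases rule: compiled_cases)
        (auto simp: clause_set_defs clause_atoms_def lit_atom_def body_atom_def defeated_atom_def
          assms R_fact R_rule)
  qed
qed

theorem datalog_program_compiled_iff: "datalog_program (compiled D) \<longleftrightarrow> function_free D"
  unfolding datalog_program_def funs_trm_empty_iff[symmetric]
  by (subst all_compiled_terms_iff) (auto simp: function_free_def atom_funs_def set_lit_args)

theorem variable_free_compiled_iff:
  "variable_free_program (compiled D) \<longleftrightarrow> variable_free_theory D"
proof -
  have "variable_free_program (compiled D) \<longleftrightarrow>
      (\<forall>c\<in>compiled D. \<forall>A\<in>clause_atoms c. \<forall>t\<in>set (args A). vars_trm t = {})"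
    by (auto simp: variable_free_program_def atom_vars_def)
  also have "\<dots> \<longleftrightarrow> variable_free_theory D"
    by (subst all_compiled_terms_iff)
      (auto simp: variable_free_theory_def atom_vars_def set_lit_args)
  finally show ?thesis .
qed

lemma safe_program_imp_range_restricted: "safe_program P \<Longrightarrow> range_restricted_program P"
  by (force simp: safe_program_def range_restricted_program_def clause_atoms_def)

lemma range_restricted_compiled_imp_theory:
  assumes "range_restricted_program (compiled D)"
  shows "range_restricted_theory D"
  using assms[unfolded range_restricted_program_def, rule_format, OF compiled_intros(1)]
    assms[unfolded range_restricted_program_def, rule_format, OF compiled_intros(2)]
  by (simp add: range_restricted_theory_def)

text \<open>Negative literals repeat the arguments of the head up to a label constant, so they add
  no variables. Range-restriction of \<open>D\<close> enters at the unit clauses and the clauses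
  defining body predicates; elsewhere the single positive literal carries the head's
  variables.\<close>

lemma range_restricted_theory_imp_safe:
  assumes "range_restricted_theory D"
  shows "safe_program (compiled D)"
  unfolding safe_program_def
proof (rule ballI)
  fix c assume "c \<in> compiled D"
  moreover have "atom_vars (atom_of q) = {}" if "q \<in> facts D" for q
    using assms that by (simp add: range_restricted_theory_def)
  moreover have "\<exists>q\<in>antecedent r. x \<in> atom_vars (atom_of q)"
    if "r \<in> rules D" "x \<in> atom_vars (atom_of (consequent r))" for r x
    using assms that unfolding range_restricted_theory_def by blast
  ultimately show "(\<Union>A\<in>clause_atoms c. atom_vars A) \<subseteq> (\<Union>B\<in>pos_body c. atom_vars B)"
    by (cases rule: compiled_cases) (auto simp: clause_set_defs clause_atoms_def)
qed

subsection \<open>Call-consistency\<close>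

fun tier :: "('l, 'p) cpred \<Rightarrow> nat" where
  "tier (Definitely q) = 0"
| "tier (Body_Delta l) = 0"
| "tier (Lambda q) = 1"
| "tier (Body_lambda l) = 1"
| "tier _ = 2"

text \<open>Inside tier 2 the negative dependencies are Defeasibly on Overruled and Overruled on
  Defeated, each with exactly one end Overruled; no positive dependency inside the tier touches
  Overruled.\<close>

fun polarity :: "('l, 'p) cpred \<Rightarrow> int" where
  "polarity (Overruled q) = -1"
| "polarity _ = 1"

lemma polarity_square [simp]: "polarity p * polarity p = 1"
  by (cases p) auto

lemma directly_depends_tier:
  assumes "directly_depends (compiled D) i p q"
  shows "tier q \<le> tier p \<and> (tier q = tier p \<longrightarrow> i = polarity p * polarity q)"
proof -
  have "\<forall>B\<in>pos_body c. tier (pred B) \<le> tier (pred (head c)) \<and>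
        (tier (pred B) = tier (pred (head c)) \<longrightarrow> polarity (pred (head c)) * polarity (pred B) = 1)"
    and "\<forall>B\<in>neg_body c. tier (pred B) \<le> tier (pred (head c)) \<and>
        (tier (pred B) = tier (pred (head c)) \<longrightarrow> polarity (pred (head c)) * polarity (pred B) = -1)"
    if "c \<in> compiled D" for c
    using that
    by (cases rule: compiled_cases;
        auto simp: clause_set_defs lit_atom_def body_atom_def defeated_atom_def)+
  with assms show ?thesis
    by cases auto
qed

text \<open>Tiers never rise along a path, so equal tiers at the ends force every predicate in
  between into that tier. The signs then telescope, since each inner polarity occurs twice.\<close>

lemma depends_tier:
  assumes "depends (compiled D) i p q"
  shows "tier q \<le> tier p \<and> (tier q = tier p \<longrightarrow> i = polarity p * polarity q)"
  using assms
proof induction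
  case (refl p)
  then show ?case by simp
next
  case (step i p q j r)
  have "polarity p * polarity q * (polarity q * polarity r) = polarity p * polarity r"
    by (metis mult.assoc mult.right_neutral polarity_square)
  then show ?case
    using step.IH directly_depends_tier[OF step.hyps(1)] by auto
qed

theorem call_consistent_compiled: "call_consistent (compiled D)"
  unfolding call_consistent_def using depends_tier by fastforce

subsection \<open>Stratification\<close>

text \<open>\<open>Body_d\<close> carries only a label; \<open>h\<close> is meant to recover the
  predicate of that rule's consequent.\<close>

fun stratum :: "('l \<Rightarrow> 'p) \<Rightarrow> ('p \<Rightarrow> nat) \<Rightarrow> ('l, 'p) cpred \<Rightarrow> nat" where
  "stratum h w (Definitely q) = 0"
| "stratum h w (Body_Delta l) = 0"
| "stratum h w (Lambda q) = 1"
| "stratum h w (Body_lambda l) = 1"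
| "stratum h w (Defeasibly q) = 3 * w (atom_of q) + 4"
| "stratum h w (Overruled q) = 3 * w (atom_of q) + 3"
| "stratum h w (Defeated q) = 3 * w (atom_of q) + 2"
| "stratum h w (Body_d l) = 3 * w (h l) + 2"

fun literal_args :: "(('l, 'p) cpred, 't) atom \<Rightarrow> 't list" where
  "literal_args (Atom (Defeated q) ts) = tl ts"
| "literal_args (Atom _ ts) = ts"

lemma literal_args_subst: "literal_args (subst_atom \<sigma> A) = map (subst \<sigma>) (literal_args A)"
  by (cases A rule: literal_args.cases) (auto simp: subst_atom_def map_tl)

text \<open>The weight may depend on the arguments, so that one level function serves both
  stratification (arguments ignored) and local stratification (a weight per ground atom).\<close>

definition atom_stratum ::
  "('l \<Rightarrow> 'p) \<Rightarrow> ('p \<Rightarrow> 't list \<Rightarrow> nat) \<Rightarrow> (('l, 'p) cpred, 't) atom \<Rightarrow> nat" where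
  "atom_stratum h w A = stratum h (\<lambda>p. w p (literal_args A)) (pred A)"

lemma atom_stratum_compiled [simp]:
  "atom_stratum h w (lit_atom Definitely q) = 0"
  "atom_stratum h w (lit_atom Lambda q) = 1"
  "atom_stratum h w (lit_atom Defeasibly q) = 3 * w (pred (atom_of q)) (lit_args q) + 4"
  "atom_stratum h w (lit_atom Overruled q) = 3 * w (pred (atom_of q)) (lit_args q) + 3"
  "atom_stratum h w (defeated_atom q s) = 3 * w (pred (atom_of q)) (lit_args q) + 2"
  "atom_stratum h w (body_atom Body_Delta r) = 0"
  "atom_stratum h w (body_atom Body_lambda r) = 1"
  "atom_stratum h w (body_atom Body_d r) = 3 * w (h (label r)) (lit_args (consequent r)) + 2"
  by (simp_all add: atom_stratum_def lit_atom_def body_atom_def defeated_atom_def)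

lemma atom_stratum_subst:
  "atom_stratum h w (subst_atom \<sigma> A) = atom_stratum h (\<lambda>p ts. w p (map (subst \<sigma>) ts)) A"
proof -
  have "pred (subst_atom \<sigma> A) = pred A"
    by (cases A) (simp add: subst_atom_def)
  then show ?thesis
    by (simp add: atom_stratum_def literal_args_subst)
qed

lemma compiled_stratum:
  assumes "c \<in> compiled D"
    and h: "\<And>r. r \<in> rules D \<Longrightarrow> h (label r) = pred (atom_of (consequent r))"
    and w: "\<And>r q. r \<in> rules D \<Longrightarrow> q \<in> antecedent r \<Longrightarrow>
      w (pred (atom_of q)) (lit_args q) <
      w (pred (atom_of (consequent r))) (lit_args (consequent r))"
  shows "\<forall>B\<in>pos_body c. atom_stratum h w B \<le> atom_stratum h w (head c)"
    and "\<forall>B\<in>neg_body c. atom_stratum h w B < atom_stratum h w (head c)"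
proof -
  \<comment> \<open>This is the requirement Defeasibly \<le> \<open>Body_d\<close>, that is 3w(q) +
    4 \<le> 3w(r) + 2, with 2 cancelled. It is the one place where the decrease of \<open>w\<close>
    is spent, and the factor 3 makes a drop by 1 enough.\<close>
  have "3 * w (pred (atom_of q)) (lit_args q) + 2 \<le>
      3 * w (pred (atom_of (consequent r))) (lit_args (consequent r))"
    if "r \<in> rules D" "q \<in> antecedent r" for r q
    using w[OF that] by linarith
  with assms(1) show "\<forall>B\<in>pos_body c. atom_stratum h w B \<le> atom_stratum h w (head c)"
    by (cases rule: compiled_cases) (auto simp: clause_set_defs h)
  show "\<forall>B\<in>neg_body c. atom_stratum h w B < atom_stratum h w (head c)"
    using assms(1) by (cases rule: compiled_cases) (auto simp: clause_set_defs)
qed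

text \<open>A label identifies its rule, so inverting \<open>label\<close> on the rules gives the
  map.\<close>

lemma obtain_label_map:
  assumes "defeasible_theory D"
  obtains h where "\<And>r. r \<in> rules D \<Longrightarrow> h (label r) = pred (atom_of (consequent r))"
proof
  fix r assume "r \<in> rules D"
  then show "(\<lambda>l. pred (atom_of (consequent (the_inv_into (rules D) label l)))) (label r) =
      pred (atom_of (consequent r))"
    using assms by (simp add: defeasible_theory_def the_inv_into_f_f)
qed

theorem hierarchical_imp_stratified:
  fixes D :: "('l, ('p, ('c, 'f, 'v) trm) atom) dtheory"
  assumes "defeasible_theory D" and "hierarchical D"
  shows "stratified (compiled D)"
proof -
  obtain h where h: "\<And>r. r \<in> rules D \<Longrightarrow> h (label r) = pred (atom_of (consequent r))"
    using obtain_label_map[OF assms(1)] by blast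
  from assms(2) obtain m :: "'p \<Rightarrow> nat" where "\<forall>r\<in>rules D. \<forall>q\<in>antecedent r.
      m (pred (atom_of q)) < m (pred (atom_of (consequent r)))"
    unfolding hierarchical_def hierarchical_rules_def ..
  then have m: "m (pred (atom_of q)) < m (pred (atom_of (consequent r)))"
    if "r \<in> rules D" "q \<in> antecedent r" for r q
    using that by blast
  show ?thesis
    unfolding stratified_def
    using compiled_stratum[where h = h and w = "\<lambda>p ts. m p", OF _ h m, unfolded atom_stratum_def]
    by (intro exI[of _ "stratum h m"]) blast
qed

text \<open>After \<open>prop_atom\<close> the predicate is the whole instantiated atom, so a level
  map for the propositional theory is a weight on ground atoms.\<close>

lemma pred_literal_instance:
  "pred (atom_of (map_literal prop_atom (map_literal (subst_atom \<sigma>) q))) =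
    Atom (pred (atom_of q)) (map (subst \<sigma>) (args (atom_of q)))"
  by (cases q; cases "atom_of q") (auto simp: prop_atom_def subst_atom_def)

theorem locally_hierarchical_imp_locally_stratified:
  fixes D :: "('l, ('p, ('c, 'f, 'v) trm) atom) dtheory"
  assumes "defeasible_theory D" and "locally_hierarchical D"
  shows "locally_stratified (compiled D)"
proof -
  obtain h where h: "\<And>r. r \<in> rules D \<Longrightarrow> h (label r) = pred (atom_of (consequent r))"
    using obtain_label_map[OF assms(1)] by blast
  from assms(2) obtain m :: "('p, ('c, 'f, 'v) trm) atom \<Rightarrow> nat"
    where m: "\<forall>r\<in>map_rule_atoms prop_atom ` ground_rules (rules D). \<forall>q\<in>antecedent r.
      m (pred (atom_of q)) < m (pred (atom_of (consequent r)))"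
    unfolding locally_hierarchical_def hierarchical_rules_def ..
  have m_instance: "m (Atom (pred (atom_of q)) (map (subst \<sigma>) (args (atom_of q)))) <
      m (Atom (pred (atom_of (consequent r))) (map (subst \<sigma>) (args (atom_of (consequent r)))))"
    if "r \<in> rules D" "q \<in> antecedent r" "ground_subst \<sigma>" for r q \<sigma>
  proof -
    have "map_rule_atoms prop_atom (map_rule_atoms (subst_atom \<sigma>) r) \<in>
        map_rule_atoms prop_atom ` ground_rules (rules D)"
      using that by (auto simp: ground_rules_def)
    from bspec[OF m this] that(2) show ?thesis
      by (simp add: map_rule_atoms_def pred_literal_instance)
  qed
  \<comment> \<open>Ground instances of the program may put rule labels where \<open>D\<close> expects its own constants;
     collapsing the labels to one constant turns them into instances of \<open>D\<close>.\<close>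
  define g :: "'c + 'l \<Rightarrow> 'c" where "g = case_sum id (\<lambda>_. undefined)"
  define w where "w p ts = m (Atom p (map (map_trm g id id) ts))" for p ts
  have g: "g \<circ> Inl = id"
    by (auto simp: g_def)
  have w_instance: "w (pred (atom_of q)) (map (subst \<sigma>) (lit_args q)) <
      w (pred (atom_of (consequent r))) (map (subst \<sigma>) (lit_args (consequent r)))"
    if "r \<in> rules D" "q \<in> antecedent r" "ground_subst \<sigma>" for r q \<sigma>
  proof -
    \<comment> \<open>Collapsing labels in an instance under \<open>\<sigma>\<close> amounts to
      instantiating in the language of \<open>D\<close> with this composed substitution.\<close>
    have "ground_subst (map_trm g id id \<circ> \<sigma>)"
      using that(3) by (simp add: ground_subst_def)
    from m_instance[OF that(1,2) this] show ?thesis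
      by (simp add: w_def lit_args_def map_consts_subst[OF g] comp_def)
  qed
  \<comment> \<open>The substitution is moved into the weight, so \<open>compiled_stratum\<close>
    applies to the uninstantiated clause. The level map itself does not depend on
    \<open>\<sigma>\<close>, so it serves all ground instances at once.\<close>
  have "(\<forall>B\<in>pos_body c. atom_stratum h w (subst_atom \<sigma> B) \<le> atom_stratum h w (subst_atom \<sigma> (head c))) \<and>
      (\<forall>B\<in>neg_body c. atom_stratum h w (subst_atom \<sigma> B) < atom_stratum h w (subst_atom \<sigma> (head c)))"
    if "c \<in> compiled D" "ground_subst \<sigma>" for c \<sigma>
    using compiled_stratum[where w = "\<lambda>p ts. w p (map (subst \<sigma>) ts)",
        OF that(1) h w_instance[OF _ _ that(2)]]
    unfolding atom_stratum_subst by simp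
  then show ?thesis
    unfolding locally_stratified_def stratified_def
    by (intro exI[of _ "atom_stratum h w"])
      (auto simp: ground_clauses_def map_clause_atoms_def prop_atom_def)
qed

theorem theorem7:
  fixes D :: "('l, ('p, ('c, 'f, 'v) trm) atom) dtheory"
  assumes "defeasible_theory D"
  shows "(datalog_program (compiled D) \<longleftrightarrow> function_free D) \<and>
         (variable_free_program (compiled D) \<longleftrightarrow> variable_free_theory D) \<and>
         (range_restricted_program (compiled D) \<longleftrightarrow> range_restricted_theory D) \<and>
         (safe_program (compiled D) \<longleftrightarrow> range_restricted_theory D) \<and>
         call_consistent (compiled D) \<and>
         (hierarchical D \<longrightarrow> stratified (compiled D)) \<and>
         (locally_hierarchical D \<longrightarrow> locally_stratified (compiled D))"
proof (intro conjI impI)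
  \<comment> \<open>Parts (3) and (4) follow from a cycle: range-restricted program,
    range-restricted theory, safe program, and back.\<close>
  show "range_restricted_program (compiled D) \<longleftrightarrow> range_restricted_theory D"
    by (metis range_restricted_compiled_imp_theory range_restricted_theory_imp_safe
        safe_program_imp_range_restricted)
  show "safe_program (compiled D) \<longleftrightarrow> range_restricted_theory D"
    by (metis range_restricted_compiled_imp_theory range_restricted_theory_imp_safe
        safe_program_imp_range_restricted)
qed (use assms in \<open>simp_all add: datalog_program_compiled_iff variable_free_compiled_iff
  call_consistent_compiled hierarchical_imp_stratified
  locally_hierarchical_imp_locally_stratified\<close>)

end
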